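(* Let $S$ be a semigroup and let $A$ be a subsemigroup of $S$. The following two assertions are equivalent: (i) $A=\mathrm{Sep}A$; (ii) $A$ is a unitary subsemigroup of $S$.
   Context: For a subset $A$ of a semigroup $S$, write $\overline{A}=S\setminus A$. The separator of $A$, denoted $\mathrm{Sep}A$, is the set of all $x\in S$ such that $xA\subseteq A$, $Ax\subseteq A$, $x\overline{A}\subseteq\overline{A}$ and $\overline{A}x\subseteq\overline{A}$. A subsemigroup $U$ of $S$ is called unitary if, for all $a,b\in S$, $ab\in U$ and $a\in U$ imply $b\in U$, and $ab\in U$ and $b\in U$ imply $a\in U$. Semigroups and subsemigroups are non-empty by convention. *)

theory Defs
  imports Main
begin

definition subsemigroup :: "'a::semigroup_mult set \<Rightarrow> bool" where
  "subsemigroup U \<longleftrightarrow> U \<noteq> {} \<and> (\<forall>a\<in>U. \<forall>b\<in>U. a * b \<in> U)"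

definition separator :: "'a::semigroup_mult set \<Rightarrow> 'a set" where
  "separator A = {x. (\<lambda>a. x * a) ` A \<subseteq> A \<and> (\<lambda>a. a * x) ` A \<subseteq> A \<and>
                     (\<lambda>a. x * a) ` (- A) \<subseteq> - A \<and> (\<lambda>a. a * x) ` (- A) \<subseteq> - A}"

definition unitary_subsemigroup :: "'a::semigroup_mult set \<Rightarrow> bool" where
  "unitary_subsemigroup U \<longleftrightarrow> subsemigroup U \<and>
     (\<forall>a b. (a * b \<in> U \<and> a \<in> U \<longrightarrow> b \<in> U) \<and> (a * b \<in> U \<and> b \<in> U \<longrightarrow> a \<in> U))"

end

theory Submission
  imports Defs
begin

text \<open>Membership in the separator says that multiplying by \<open>x\<close> on either side
  both preserves and reflects membership in \<open>A\<close>. For \<open>x\<close> in the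
  subsemigroup \<open>A\<close>, preserving is closure and reflecting is exactly unitarity.\<close>

text \<open>The inclusions for the complement of \<open>A\<close> are the contrapositives of the
  reflecting directions.\<close>

lemma separator_iff:
  "x \<in> separator A \<longleftrightarrow> (\<forall>a. (x * a \<in> A \<longleftrightarrow> a \<in> A) \<and> (a * x \<in> A \<longleftrightarrow> a \<in> A))"
  unfolding separator_def by blast

theorem theorem8:
  fixes A :: "'a::semigroup_mult set"
  assumes "subsemigroup A"
  shows "A = separator A \<longleftrightarrow> unitary_subsemigroup A"
proof
  assume "A = separator A"
  then have "\<And>x a. x \<in> A \<Longrightarrow> (x * a \<in> A \<longleftrightarrow> a \<in> A) \<and> (a * x \<in> A \<longleftrightarrow> a \<in> A)"
    using separator_iff by blast
  with assms show "unitary_subsemigroup A"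
    unfolding unitary_subsemigroup_def by blast
next
  assume unitary: "unitary_subsemigroup A"
  show "A = separator A"
  proof
    show "A \<subseteq> separator A"
      using unitary
      unfolding separator_iff subset_iff unitary_subsemigroup_def subsemigroup_def by blast
  next
    \<comment> \<open>For \<open>x\<close> in the separator, \<open>x * a\<close> lies in
      \<open>A\<close> along with \<open>a\<close>, so unitarity forces \<open>x\<close> into
      \<open>A\<close>; nonemptiness of \<open>A\<close> supplies such an \<open>a\<close>.\<close>
    obtain a where "a \<in> A"
      using assms unfolding subsemigroup_def by blast
    then show "separator A \<subseteq> A"
      using unitary
      unfolding separator_iff subset_iff unitary_subsemigroup_def by blast
  qed
qed

end
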